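(* Let $\mathcal{A}$ be a unital $C^*$-algebra, let $\mathcal{F}\subseteq\mathcal{A}$ be an ideal of finite type elements, and let $a\in\mathcal{A}$ be invertible. Suppose that $K(\mathcal{F})$ satisfies the cancellation property, i.e. for any pair of projections $p,q\in\mathcal{F}$ we have $p\sim q$ whenever $[p]=[q]$ in $K(\mathcal{F})$. Then for every $f\in\mathcal{F}$, $a+f$ is left invertible in $\mathcal{A}$ if and only if $a+f$ is right invertible in $\mathcal{A}$.
   Context: Ideal of finite type elements: a subalgebra $\mathcal{F}\subseteq\mathcal{A}$ such that (i) $\mathcal{F}$ is a selfadjoint ideal: $ab,ba\in\mathcal{F}$ for all $a\in\mathcal{A}$, $b\in\mathcal{F}$, and $a\in\mathcal{F}$ implies $a^*\in\mathcal{F}$; (ii) there is an approximate unit $(p_\alpha)$ (in the norm topology) for $\mathcal{F}$ consisting of projections; (iii) if $p,q\in\mathcal{F}$ are projections, then there exists $v\in\mathcal{A}$ such that $vv^*=q$ and $v^*v\perp p$, i.e. $v^*v+p$ is a projection. For projections $p,q$: $p\sim q$ means there is $v\in\mathcal{A}$ with $vv^*=p$, $v^*v=q$ (Murray-von Neumann equivalence). $S(\mathcal{F})=\mathrm{Proj}(\mathcal{F})/\!\sim$ is a commutative semigroup under the addition of orthogonal representatives: $[p]+[q]=[p+q']$ where $q'\sim q$, $q'\perp p$ (such $q'$ exists by (iii)). $K(\mathcal{F})$ is the Grothendieck group of $S(\mathcal{F})$, and $[p]$ also denotes the class of $p$ in $K(\mathcal{F})$. *)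

theory Defs
  imports "HOL-Analysis.Analysis" "HOL-Algebra.Group"
begin

class scaleC =
  fixes scaleC :: "complex \<Rightarrow> 'a \<Rightarrow> 'a"  (infixr \<open>*\<^sub>C\<close> 75)

class star =
  fixes star :: "'a \<Rightarrow> 'a"

class cstar_algebra = real_normed_algebra + banach + scaleC + star +
  assumes scaleC_add_right: "c *\<^sub>C (x + y) = c *\<^sub>C x + c *\<^sub>C y"
    and scaleC_add_left: "(c + d) *\<^sub>C x = c *\<^sub>C x + d *\<^sub>C x"
    and scaleC_scaleC: "c *\<^sub>C (d *\<^sub>C x) = (c * d) *\<^sub>C x"
    and scaleC_one: "1 *\<^sub>C x = x"
    and scaleR_scaleC: "r *\<^sub>R x = complex_of_real r *\<^sub>C x"
    and norm_scaleC: "norm (c *\<^sub>C x) = cmod c * norm x"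
    and mult_scaleC_left: "(c *\<^sub>C x) * y = c *\<^sub>C (x * y)"
    and mult_scaleC_right: "x * (c *\<^sub>C y) = c *\<^sub>C (x * y)"
    and star_add: "star (x + y) = star x + star y"
    and star_scaleC: "star (c *\<^sub>C x) = cnj c *\<^sub>C star x"
    and star_mult: "star (x * y) = star y * star x"
    and star_star: "star (star x) = x"
    and cstar_identity: "norm (star x * x) = (norm x)\<^sup>2"

text \<open>The unit is not required to differ from 0, so the zero algebra is included.\<close>

class unital_cstar_algebra = cstar_algebra + monoid_mult

definition is_projection :: "'a::cstar_algebra \<Rightarrow> bool" where
  "is_projection p \<longleftrightarrow> p * p = p \<and> star p = p"

definition projections :: "'a::cstar_algebra set \<Rightarrow> 'a set" where
  "projections F = {p \<in> F. is_projection p}"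

definition proj_orthogonal :: "'a::cstar_algebra \<Rightarrow> 'a \<Rightarrow> bool" where
  "proj_orthogonal p q \<longleftrightarrow> is_projection p \<and> is_projection q \<and> is_projection (p + q)"

definition complex_subalgebra :: "'a::cstar_algebra set \<Rightarrow> bool" where
  "complex_subalgebra F \<longleftrightarrow>
     0 \<in> F \<and> (\<forall>x\<in>F. \<forall>y\<in>F. x + y \<in> F) \<and> (\<forall>c. \<forall>x\<in>F. c *\<^sub>C x \<in> F) \<and>
     (\<forall>x\<in>F. \<forall>y\<in>F. x * y \<in> F)"

definition directed_preorder :: "'i set \<Rightarrow> ('i \<Rightarrow> 'i \<Rightarrow> bool) \<Rightarrow> bool" where
  "directed_preorder I leq \<longleftrightarrow>
     I \<noteq> {} \<and> (\<forall>i\<in>I. leq i i) \<and>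
     (\<forall>i\<in>I. \<forall>j\<in>I. \<forall>k\<in>I. leq i j \<longrightarrow> leq j k \<longrightarrow> leq i k) \<and>
     (\<forall>i\<in>I. \<forall>j\<in>I. \<exists>k\<in>I. leq i k \<and> leq j k)"

definition net_converges ::
  "'i set \<Rightarrow> ('i \<Rightarrow> 'i \<Rightarrow> bool) \<Rightarrow> ('i \<Rightarrow> 'a::real_normed_vector) \<Rightarrow> 'a \<Rightarrow> bool" where
  "net_converges I leq x l \<longleftrightarrow>
     (\<forall>e>0. \<exists>i\<in>I. \<forall>j\<in>I. leq i j \<longrightarrow> norm (x j - l) < e)"

definition approximate_unit ::
  "'i set \<Rightarrow> ('i \<Rightarrow> 'i \<Rightarrow> bool) \<Rightarrow> ('i \<Rightarrow> 'a::cstar_algebra) \<Rightarrow> 'a set \<Rightarrow> bool" where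
  "approximate_unit I leq u F \<longleftrightarrow>
     directed_preorder I leq \<and> (\<forall>i\<in>I. u i \<in> F) \<and>
     (\<forall>x\<in>F. net_converges I leq (\<lambda>i. u i * x) x \<and> net_converges I leq (\<lambda>i. x * u i) x)"

text \<open>HOL cannot quantify over the index type of the net inside a formula, so that type is an
  argument. As a free type variable in the hypothesis of a theorem it is arbitrary.\<close>

definition finite_type_ideal :: "'i itself \<Rightarrow> 'a::unital_cstar_algebra set \<Rightarrow> bool" where
  "finite_type_ideal (_ :: 'i itself) F \<longleftrightarrow>
     complex_subalgebra F \<and>
     (\<forall>a. \<forall>b\<in>F. a * b \<in> F \<and> b * a \<in> F) \<and> (\<forall>a\<in>F. star a \<in> F) \<and>
     (\<exists>(I :: 'i set) leq u. approximate_unit I leq u F \<and> (\<forall>i\<in>I. is_projection (u i))) \<and>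
     (\<forall>p\<in>projections F. \<forall>q\<in>projections F.
        \<exists>v. v * star v = q \<and> proj_orthogonal (star v * v) p)"

definition mvn_equiv :: "'a::cstar_algebra \<Rightarrow> 'a \<Rightarrow> bool" where
  "mvn_equiv p q \<longleftrightarrow> (\<exists>v. v * star v = p \<and> star v * v = q)"

definition mvn_rel :: "'a::cstar_algebra set \<Rightarrow> ('a \<times> 'a) set" where
  "mvn_rel F = {(p, q). p \<in> projections F \<and> q \<in> projections F \<and> mvn_equiv p q}"

text \<open>The union in the product ranges over orthogonal representatives. For an ideal of finite type
  elements it is a union of a nonempty family of equal classes, as usual for operations on
  quotients. The semigroup has the class of 0 as neutral element.\<close>

definition proj_semigroup :: "'a::cstar_algebra set \<Rightarrow> 'a set monoid" where
  "proj_semigroup F =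
     \<lparr>carrier = projections F // mvn_rel F,
      mult = (\<lambda>X Y. \<Union>p\<in>X. \<Union>q\<in>{q \<in> Y. proj_orthogonal p q}. mvn_rel F `` {p + q}),
      one = mvn_rel F `` {0}\<rparr>"

definition grothendieck_rel :: "('b, 'c) monoid_scheme \<Rightarrow> (('b \<times> 'b) \<times> ('b \<times> 'b)) set" where
  "grothendieck_rel M =
     {((x, y), (x', y')). x \<in> carrier M \<and> y \<in> carrier M \<and> x' \<in> carrier M \<and> y' \<in> carrier M \<and>
        (\<exists>z\<in>carrier M. x \<otimes>\<^bsub>M\<^esub> y' \<otimes>\<^bsub>M\<^esub> z = x' \<otimes>\<^bsub>M\<^esub> y \<otimes>\<^bsub>M\<^esub> z)}"

definition grothendieck_group :: "('b, 'c) monoid_scheme \<Rightarrow> ('b \<times> 'b) set monoid" where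
  "grothendieck_group M =
     \<lparr>carrier = (carrier M \<times> carrier M) // grothendieck_rel M,
      mult = (\<lambda>X Y. \<Union>(x, y)\<in>X. \<Union>(x', y')\<in>Y.
                grothendieck_rel M `` {(x \<otimes>\<^bsub>M\<^esub> x', y \<otimes>\<^bsub>M\<^esub> y')}),
      one = grothendieck_rel M `` {(\<one>\<^bsub>M\<^esub>, \<one>\<^bsub>M\<^esub>)}\<rparr>"

definition grothendieck_map :: "('b, 'c) monoid_scheme \<Rightarrow> 'b \<Rightarrow> ('b \<times> 'b) set" where
  "grothendieck_map M x = grothendieck_rel M `` {(x, \<one>\<^bsub>M\<^esub>)}"

definition K_group :: "'a::cstar_algebra set \<Rightarrow> ('a set \<times> 'a set) set monoid" where
  "K_group F = grothendieck_group (proj_semigroup F)"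

definition K_class :: "'a::cstar_algebra set \<Rightarrow> 'a \<Rightarrow> ('a set \<times> 'a set) set" where
  "K_class F p = grothendieck_map (proj_semigroup F) (mvn_rel F `` {p})"

definition K_cancellation :: "'a::cstar_algebra set \<Rightarrow> bool" where
  "K_cancellation F \<longleftrightarrow>
     (\<forall>p\<in>projections F. \<forall>q\<in>projections F. K_class F p = K_class F q \<longrightarrow> mvn_equiv p q)"

definition left_invertible :: "'a::monoid_mult \<Rightarrow> bool" where
  "left_invertible x \<longleftrightarrow> (\<exists>y. y * x = 1)"

definition right_invertible :: "'a::monoid_mult \<Rightarrow> bool" where
  "right_invertible x \<longleftrightarrow> (\<exists>y. x * y = 1)"

definition two_sided_invertible :: "'a::monoid_mult \<Rightarrow> bool" where
  "two_sided_invertible x \<longleftrightarrow> (\<exists>y. x * y = 1 \<and> y * x = 1)"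

end

theory Submission imports Defs begin

text \<open>After multiplying by the inverse of \<open>a\<close> and, for right invertibility, passing to adjoints, it
  suffices to show that a left invertible \<open>1 + g\<close> with \<open>g \<in> F\<close> is invertible. Both properties are
  stable under small perturbations, so \<open>g\<close> may be replaced by \<open>p * g * p\<close> for a projection
  \<open>p \<in> F\<close> from the approximate unit. Then \<open>p\<close> commutes with \<open>x = 1 + p * g * p\<close>, and the isometry
  \<open>v\<close> in the polar decomposition of \<open>x\<close> yields \<open>p \<sim> v * p * star v = r \<le> p\<close>. In \<open>K(F)\<close> this
  gives \<open>[p - r] = 0\<close>, so \<open>r = p\<close> by cancellation, and \<open>v\<close>, hence \<open>x\<close>, is invertible.

  The polar decomposition is obtained without spectral theory: inverses and square roots near \<open>1\<close>
  come from the Banach fixed point theorem, and Kaplansky's argument shows that \<open>star x * x\<close> is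
  positive.\<close>

section \<open>The involution\<close>

lemma star_zero [simp]: "star (0::'a::cstar_algebra) = 0"
  by (metis add_cancel_right_left star_add)

lemma star_minus [simp]: "star (- x) = - star (x::'a::cstar_algebra)"
  by (metis add.right_inverse minus_unique star_add star_zero)

lemma star_diff: "star (x - y) = star x - star (y::'a::cstar_algebra)"
  by (metis diff_conv_add_uminus star_add star_minus)

lemma star_scaleR: "star (r *\<^sub>R x) = r *\<^sub>R star (x::'a::cstar_algebra)"
  by (simp add: scaleR_scaleC star_scaleC)

lemma star_one [simp]: "star (1::'a::unital_cstar_algebra) = 1"
  by (metis mult_1_left mult_1_right star_mult star_star)

lemma scaleC_minus_i [simp]: "(- \<i>) *\<^sub>C x = - (\<i> *\<^sub>C (x::'a::cstar_algebra))"
  by (metis add.right_inverse add_eq_0_iff scaleC_add_left scaleR_scaleC of_real_0 scaleR_zero_left)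

lemma scaleC_i_i [simp]: "\<i> *\<^sub>C \<i> *\<^sub>C x = - (x::'a::cstar_algebra)"
  by (metis scaleC_minus_i scaleC_scaleC scaleC_one i_squared mult_minus_left add.inverse_inverse)

lemma scaleC_diff_right: "c *\<^sub>C (x - y) = c *\<^sub>C x - c *\<^sub>C (y::'a::cstar_algebra)"
  by (metis add_diff_cancel diff_add_cancel scaleC_add_right)

text \<open>Multiplication by the imaginary unit makes \<open>k\<close> selfadjoint, which brings
  \<open>- (k * k)\<close> under the results on selfadjoint squares.\<close>

lemma skew_adjoint_square:
  fixes k :: "'a::cstar_algebra"
  assumes "star k = - k"
  obtains s where "star s = s" "s * s = - (k * k)"
proof
  show "star (\<i> *\<^sub>C k) = \<i> *\<^sub>C k"
    using assms scaleC_diff_right[of \<i> 0 k] scaleC_diff_right[of \<i> 0 0] by (simp add: star_scaleC)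
  show "(\<i> *\<^sub>C k) * (\<i> *\<^sub>C k) = - (k * k)"
    by (simp add: mult_scaleC_left mult_scaleC_right)
qed

lemma norm_star [simp]: "norm (star x) = norm (x::'a::cstar_algebra)"
proof -
  have le: "norm z \<le> norm (star z)" for z :: 'a
  proof (cases "norm z = 0")
    case False
    have "norm z * norm z \<le> norm (star z) * norm z"
      by (metis cstar_identity norm_mult_ineq power2_eq_square)
    then show ?thesis using False by simp
  qed simp
  show ?thesis using le[of x] le[of "star x"] by (simp add: star_star)
qed

text \<open>The C*-identity makes \<open>norm 1\<close> its own square. It may be 0, since the zero
  algebra is allowed.\<close>

lemma norm_one_le: "norm (1::'a::unital_cstar_algebra) \<le> 1"
proof -
  have "norm (1::'a) = (norm (1::'a))\<^sup>2"
    using cstar_identity[of "1::'a"] by simp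
  then show ?thesis
    by (metis order.refl mult_cancel_left1 norm_zero power2_eq_square zero_le_one)
qed

lemma isometry_norm_le:
  fixes u :: "'a::unital_cstar_algebra"
  assumes "star u * u = 1" shows "norm u \<le> 1"
proof -
  have "(norm u)\<^sup>2 \<le> 1" using assms cstar_identity[of u] norm_one_le[where 'a='a] by simp
  then show ?thesis by (simp add: abs_square_le_1)
qed

lemma star_mult_self_eq_zero_iff [simp]: "star x * x = 0 \<longleftrightarrow> x = (0::'a::cstar_algebra)"
  by (metis cstar_identity mult_zero_right norm_eq_zero power_eq_0_iff)

lemma continuous_on_star: "continuous_on S (star :: 'a::cstar_algebra \<Rightarrow> 'a)"
proof (rule continuous_on_subset[OF _ subset_UNIV])
  have "dist (star x) (star y) = dist x y" for x y :: 'a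
    by (simp add: dist_norm flip: star_diff)
  then show "continuous_on UNIV (star :: 'a \<Rightarrow> 'a)"
    unfolding continuous_on_iff by auto
qed

lemma is_projection_norm_le:
  assumes "is_projection p" shows "norm (p::'a::cstar_algebra) \<le> 1"
proof -
  have "(norm p)\<^sup>2 = norm p" using assms cstar_identity[of p] by (simp add: is_projection_def)
  then show ?thesis by (metis mult_cancel_left1 norm_zero order.refl power2_eq_square zero_le_one norm_eq_zero)
qed

section \<open>Inverses and square roots near the unit\<close>

text \<open>Domain of the contraction for square roots: being closed, it passes selfadjointness and
  commutation with the commutant of \<open>b\<close> on to the fixed point.\<close>

lemma closed_commutant_fixed:
  "closed {y::'a::cstar_algebra. norm y \<le> r \<and> star y = y \<and> (\<forall>u. u * b = b * u \<longrightarrow> u * y = y * u)}"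
  by (intro closed_Collect_conj closed_Collect_all closed_Collect_imp open_Collect_const
      closed_Collect_le closed_Collect_eq continuous_intros continuous_on_star)

text \<open>The map \<open>\<lambda>u. 1 + b * u\<close> contracts with factor
  \<open>norm b\<close>, and its fixed point is a right inverse. Working inside the commutant of
  \<open>b\<close> makes it a left inverse too.\<close>

lemma one_minus_invertible:
  fixes b :: "'a::unital_cstar_algebra"
  assumes "norm b < 1"
  obtains g where "g * (1 - b) = 1" "(1 - b) * g = 1"
proof -
  let ?S = "{u. u * b = b * u}"
  have "closed ?S"
    by (intro closed_Collect_eq continuous_intros)
  then have "complete ?S" by (simp add: complete_eq_closed)
  moreover have "?S \<noteq> {}" using mult_zero_left[of b] by force
  moreover have "(\<lambda>u. 1 + b * u) ` ?S \<subseteq> ?S"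
    by (auto simp: distrib_left distrib_right mult.assoc)
  moreover have "dist (1 + b * u) (1 + b * v) \<le> norm b * dist u v" for u v
    using norm_mult_ineq[of b "u - v"] by (simp add: dist_norm algebra_simps)
  ultimately have "\<exists>!u\<in>?S. 1 + b * u = u"
    using Banach_fix[OF _ _ norm_ge_zero assms, of ?S "\<lambda>u. 1 + b * u"] by blast
  then obtain u where "u * b = b * u" "1 + b * u = u" by auto
  then have "u * (1 - b) = 1" "(1 - b) * u = 1"
    by (simp_all add: algebra_simps)
  then show ?thesis by (rule that)
qed

text \<open>The square root is \<open>1 - y\<close>, where \<open>y\<close> is the fixed point of the contraction
  \<open>y \<mapsto> (b + y\<^sup>2) / 2\<close>.\<close>

lemma one_minus_sqrt:
  fixes b :: "'a::unital_cstar_algebra"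
  assumes b: "norm b < 1" and sb: "star b = b"
  obtains c where "c * c = 1 - b" "star c = c" "norm (1 - c) < 1"
    "\<And>u. u * b = b * u \<Longrightarrow> u * c = c * u"
proof -
  define r where "r = norm b"
  have r: "0 \<le> r" "r < 1" using b by (auto simp: r_def)
  let ?S = "{y. norm y \<le> r \<and> star y = y \<and> (\<forall>u. u * b = b * u \<longrightarrow> u * y = y * u)}"
  let ?f = "\<lambda>y. (1/2) *\<^sub>R (b + y * y)"
  have "closed ?S" by (rule closed_commutant_fixed)
  then have "complete ?S" by (simp add: complete_eq_closed)
  moreover have "0 \<in> ?S" using r by simp
  then have "?S \<noteq> {}" by blast
  moreover have "?f y \<in> ?S" if y: "y \<in> ?S" for y
  proof -
    have "norm (y * y) \<le> r * r"
      using y r by (intro order_trans[OF norm_mult_ineq] mult_mono) auto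
    also have "\<dots> \<le> r" using r by (simp add: mult_left_le)
    finally have "norm (b + y * y) \<le> r + r"
      using norm_triangle_ineq[of b "y * y"] by (simp add: r_def)
    then have "norm (?f y) \<le> r" by simp
    moreover have "u * ?f y = ?f y * u" if "u * b = b * u" for u
    proof -
      have "u * y = y * u" using y that by blast
      then have "u * (y * y) = y * y * u" by (metis mult.assoc)
      then show ?thesis using that by (simp add: distrib_left distrib_right)
    qed
    moreover have "star y = y" using y by blast
    then have "star (?f y) = ?f y" using sb by (simp add: star_scaleR star_add star_mult)
    ultimately show ?thesis by (intro CollectI conjI allI impI)
  qed
  moreover have "dist (?f y) (?f z) \<le> r * dist y z" if y: "y \<in> ?S" and z: "z \<in> ?S" for y z
  proof -
    \<comment> \<open>On the ball of radius \<open>r\<close> this splitting gives the Lipschitz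
      constant \<open>r\<close>; the factor 2 is absorbed by the 1/2 in the map.\<close>
    have "y * y - z * z = y * (y - z) + (y - z) * z" by (simp add: algebra_simps)
    also have "norm \<dots> \<le> norm y * norm (y - z) + norm (y - z) * norm z"
      by (intro norm_triangle_le add_mono norm_mult_ineq)
    also have "\<dots> \<le> r * norm (y - z) + norm (y - z) * r"
      using y z r(1) by (intro add_mono mult_mono) auto
    finally have *: "norm (y * y - z * z) \<le> 2 * (r * norm (y - z))" by simp
    have "?f y - ?f z = (1/2) *\<^sub>R (y * y - z * z)" by (simp add: algebra_simps)
    then show ?thesis using * by (simp add: dist_norm)
  qed
  ultimately have "\<exists>!y\<in>?S. ?f y = y"
    using Banach_fix[OF _ _ r, of ?S ?f] by blast
  then obtain y where y: "y \<in> ?S" "?f y = y" by blast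
  have "2 *\<^sub>R y = b + y * y" by (subst y(2)[symmetric], simp)
  then have "(1 - y) * (1 - y) = 1 - b"
    by (simp add: algebra_simps scaleR_2)
  moreover have "star (1 - y) = 1 - y" "norm (1 - (1 - y)) < 1"
  proof -
    have "star y = y" "norm y \<le> r" using y(1) by blast+
    then show "star (1 - y) = 1 - y" "norm (1 - (1 - y)) < 1" using r(2) by (simp_all add: star_diff)
  qed
  moreover have "u * (1 - y) = (1 - y) * u" if "u * b = b * u" for u
  proof -
    have "u * y = y * u" using y(1) that by blast
    then show ?thesis by (simp add: algebra_simps)
  qed
  ultimately show ?thesis by (rule that)
qed

section \<open>Strictly positive elements\<close>

text \<open>For selfadjoint \<open>h\<close>, the condition \<open>norm (T *\<^sub>R 1 - h) \<le> T\<close> for some \<open>T\<close> expresses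
  positivity; the strict inequality expresses that \<open>h\<close> is moreover invertible.\<close>

definition strictly_positive :: "'a::unital_cstar_algebra \<Rightarrow> bool" where
  "strictly_positive h \<longleftrightarrow> star h = h \<and> (\<exists>T. norm (T *\<^sub>R 1 - h) < T)"

text \<open>Dividing by \<open>T\<close>, which exceeds a norm and so is positive, brings
  \<open>h\<close> into the open unit ball around 1, where inverses and roots exist.\<close>

lemma strictly_positive_cases:
  assumes "strictly_positive h"
  obtains T where "T > 0" "norm (1 - (1/T) *\<^sub>R h) < 1"
proof -
  obtain T where T: "norm (T *\<^sub>R 1 - h) < T" using assms by (auto simp: strictly_positive_def)
  then have T0: "T > 0" by (meson norm_ge_zero order_le_less_trans)
  have "1 - (1/T) *\<^sub>R h = (1/T) *\<^sub>R (T *\<^sub>R 1 - h)"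
    using T0 by (simp add: algebra_simps)
  then have "norm (1 - (1/T) *\<^sub>R h) < 1" using T T0 by simp
  then show ?thesis using T0 that by blast
qed

lemma strictly_positive_inverse:
  assumes "strictly_positive h"
  obtains g where "g * h = 1" "h * g = 1"
proof -
  obtain T where T: "T > 0" "norm (1 - (1/T) *\<^sub>R h) < 1"
    using assms by (rule strictly_positive_cases)
  obtain g where "g * (1 - (1 - (1/T) *\<^sub>R h)) = 1" "(1 - (1 - (1/T) *\<^sub>R h)) * g = 1"
    using one_minus_invertible[OF T(2)] by blast
  then have "((1/T) *\<^sub>R g) * h = 1" "h * ((1/T) *\<^sub>R g) = 1" by simp_all
  then show ?thesis by (rule that)
qed

text \<open>The root found near 1 is rescaled by \<open>sqrt T\<close>. The commutation clause takes
  the place of functional calculus in what follows.\<close>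

lemma strictly_positive_sqrt:
  fixes h :: "'a::unital_cstar_algebra"
  assumes "strictly_positive h"
  obtains c where "c * c = h" "strictly_positive c" "\<And>u. u * h = h * u \<Longrightarrow> u * c = c * u"
proof -
  have sh: "star h = h" using assms by (simp add: strictly_positive_def)
  obtain T where T: "T > 0" "norm (1 - (1/T) *\<^sub>R h) < 1"
    using assms by (rule strictly_positive_cases)
  have "star (1 - (1/T) *\<^sub>R h) = 1 - (1/T) *\<^sub>R h" by (simp add: star_diff star_scaleR sh)
  then obtain c where c: "c * c = 1 - (1 - (1/T) *\<^sub>R h)" "star c = c" "norm (1 - c) < 1"
      "\<And>u. u * (1 - (1/T) *\<^sub>R h) = (1 - (1/T) *\<^sub>R h) * u \<Longrightarrow> u * c = c * u"
    using one_minus_sqrt[OF T(2)] by blast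
  have "(sqrt T *\<^sub>R c) * (sqrt T *\<^sub>R c) = h" using T c(1) by simp
  moreover have "strictly_positive (sqrt T *\<^sub>R c)"
  proof -
    have "norm (sqrt T *\<^sub>R 1 - sqrt T *\<^sub>R c) = sqrt T * norm (1 - c)"
      using T(1) by (simp flip: scaleR_diff_right)
    also have "\<dots> < sqrt T" using c(3) T(1) by simp
    finally show ?thesis using c(2) by (auto simp: strictly_positive_def star_scaleR)
  qed
  moreover have "u * (sqrt T *\<^sub>R c) = (sqrt T *\<^sub>R c) * u" if "u * h = h * u" for u
    using c(4)[of u] that by (simp add: algebra_simps)
  ultimately show ?thesis by (rule that)
qed

lemma inverse_commute:
  fixes g :: "'a::monoid_mult"
  assumes "g * h = 1" "h * g = 1" "u * h = h * u"
  shows "u * g = g * u"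
  by (metis assms mult.assoc mult_1_left mult_1_right)

lemma star_inverse:
  fixes g :: "'a::unital_cstar_algebra"
  assumes "g * h = 1" "h * g = 1" "star h = h"
  shows "star g = g"
  by (metis assms mult.assoc mult_1_left mult_1_right star_mult star_one)

text \<open>For \<open>norm s < 1\<close> the element \<open>sqrt (1 - s\<^sup>2) + i s\<close> is unitary, and \<open>sqrt (1 - s\<^sup>2)\<close> is its
  real part; so both have norm at most 1.\<close>

lemma norm_one_minus_square_le:
  fixes s :: "'a::unital_cstar_algebra"
  assumes s: "star s = s" "norm s < 1"
  shows "norm (1 - s * s) \<le> 1"
proof -
  have "norm (s * s) < 1"
    using norm_mult_ineq[of s s] s(2) mult_le_one[of "norm s" "norm s"]
    by (smt (verit) mult_left_le norm_ge_zero)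
  moreover have "star (s * s) = s * s" by (simp add: s star_mult)
  ultimately obtain c where c: "c * c = 1 - s * s" "star c = c"
      "\<And>u. u * (s * s) = s * s * u \<Longrightarrow> u * c = c * u"
    using one_minus_sqrt by blast
  have cs: "s * c = c * s" using c(3)[of s] by (simp add: mult.assoc)
  define u where "u = c + \<i> *\<^sub>C s"
  have su: "star u = c + (- \<i>) *\<^sub>C s" by (simp add: u_def star_add star_scaleC s c)
  have "star u * u = 1"
    unfolding su by (simp add: u_def algebra_simps mult_scaleC_left mult_scaleC_right scaleC_diff_right c(1) cs)
  then have "norm u \<le> 1" by (rule isometry_norm_le)
  moreover have "2 *\<^sub>R c = u + star u" unfolding su by (simp add: u_def scaleR_2)
  ultimately have "norm (2 *\<^sub>R c) \<le> 2"
    using norm_triangle_ineq[of u "star u"] by simp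
  then have "norm c \<le> 1" by simp
  moreover have "norm (1 - s * s) = (norm c)\<^sup>2" using c(1,2) cstar_identity[of c] by simp
  ultimately show ?thesis by (simp add: power_le_one)
qed

lemma square_positive:
  fixes s :: "'a::unital_cstar_algebra"
  assumes "star s = s"
  obtains T where "norm (T *\<^sub>R 1 - s * s) \<le> T"
proof -
  \<comment> \<open>The summand 1 keeps the rescaled element strictly inside the unit ball and
    avoids division by 0.\<close>
  define t where "t = norm s + 1"
  have t: "t > 0" "norm s < t" by (auto simp: t_def add_nonneg_pos)
  have "norm (1 - ((1/t) *\<^sub>R s) * ((1/t) *\<^sub>R s)) \<le> 1"
    using t assms by (intro norm_one_minus_square_le) (auto simp: star_scaleR)
  moreover have "(t * t) *\<^sub>R 1 - s * s = (t * t) *\<^sub>R (1 - ((1/t) *\<^sub>R s) * ((1/t) *\<^sub>R s))"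
    using t by (simp add: scaleR_diff_right)
  ultimately have "norm ((t * t) *\<^sub>R 1 - s * s) \<le> t * t" using t by simp
  then show ?thesis by (rule that)
qed

text \<open>If \<open>T\<close> witnesses positivity of \<open>s * s\<close>, then
  \<open>T + e\<close> is a strict witness: the shift by \<open>e\<close> cancels inside the
  norm.\<close>

lemma scaleR_plus_square_strictly_positive:
  fixes s :: "'a::unital_cstar_algebra"
  assumes "star s = s" "e > 0"
  shows "strictly_positive (e *\<^sub>R 1 + s * s)"
proof -
  obtain T where T: "norm (T *\<^sub>R 1 - s * s) \<le> T" using assms(1) by (rule square_positive)
  have "norm ((T + e) *\<^sub>R 1 - (e *\<^sub>R 1 + s * s)) < T + e"
    using T assms(2) by (simp add: algebra_simps)
  then show ?thesis using assms
    by (auto simp: strictly_positive_def star_add star_scaleR star_mult)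
qed


text \<open>The range projection of the idempotent \<open>e = x * y\<close> is \<open>r = e * star e * m\<close>, where \<open>m\<close> is
  the inverse of \<open>1 - (e - star e)\<^sup>2\<close>. Replacing \<open>y\<close> by \<open>w = y * r\<close> makes \<open>x * w = r\<close> selfadjoint,
  and then \<open>w * star w\<close> inverts \<open>star x * x\<close>.\<close>

lemma star_mult_self_invertible:
  fixes x :: "'a::unital_cstar_algebra"
  assumes yx: "y * x = 1"
  obtains g where "g * (star x * x) = 1" "(star x * x) * g = 1"
proof -
  define e where "e = x * y"
  define f where "f = star e"
  have ee: "e * e = e" unfolding e_def by (metis yx mult.assoc mult_1_left)
  then have ff: "f * f = f" unfolding f_def by (metis star_mult)
  have "star (e - f) = - (e - f)" by (simp add: f_def star_diff star_star)
  then obtain s where s: "star s = s" "s * s = - ((e - f) * (e - f))"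
    by (rule skew_adjoint_square)
  define h where "h = 1 - e - f + e * f + f * e"
  have "1 *\<^sub>R 1 + s * s = h" unfolding s h_def by (simp add: algebra_simps ee ff)
  then have "strictly_positive h"
    using scaleR_plus_square_strictly_positive[OF s(1), of 1] by simp
  then obtain m where m: "m * h = 1" "h * m = 1" by (rule strictly_positive_inverse)
  have ee': "e * (e * z) = e * z" and ff': "f * (f * z) = f * z" for z
    using ee ff by (simp_all flip: mult.assoc)
  \<comment> \<open>\<open>h\<close> has the same products with \<open>e\<close>, and with
    \<open>f\<close>, from both sides, so its inverse \<open>m\<close> commutes with both.\<close>
  have he: "e * h = e * f * e" "h * e = e * f * e" and hf: "f * h = f * e * f" "h * f = f * e * f"
    by (simp_all add: h_def algebra_simps ee ff ee' ff')
  have em: "e * m = m * e" and fm: "f * m = m * f"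
    using he hf by (auto intro: inverse_commute[OF m])
  have sm: "star m = m"
    using \<open>strictly_positive h\<close> by (intro star_inverse[OF m]) (simp add: strictly_positive_def)
  define r where "r = e * f * m"
  \<comment> \<open>As \<open>m\<close> commutes with \<open>e\<close>, the product equals
    \<open>e * f * e * m = e * h * m\<close>.\<close>
  have re: "r * e = e" unfolding r_def
    by (metis em fm he(2) m(1) mult.assoc mult_1_left)
  have er: "e * r = r" by (simp add: r_def ee' mult.assoc)
  have sr: "star r = r" unfolding r_def
    by (metis em fm f_def mult.assoc sm star_mult star_star)
  have ex: "e * x = x" unfolding e_def by (metis yx mult.assoc mult_1_right)
  have rx: "r * x = x" by (metis re ex mult.assoc)
  define w where "w = y * r"
  have wx: "w * x = 1" by (simp add: w_def mult.assoc rx yx)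
  have xw: "x * w = r" using er by (simp add: w_def e_def mult.assoc)
  have "(star x * x) * (w * star w) = star x * (x * w) * star w" by (simp add: mult.assoc)
  also have "\<dots> = star (w * (r * x))" by (simp add: xw star_mult sr mult.assoc)
  finally have right: "(star x * x) * (w * star w) = 1" by (simp add: rx wx)
  then have "star ((star x * x) * (w * star w)) = 1" by simp
  then have "(w * star w) * (star x * x) = 1" by (simp add: star_mult star_star)
  then show ?thesis using right by (rule that)
qed

text \<open>With \<open>a = |h|\<close> and \<open>n\<close> the spectral projection of \<open>h = star x * x\<close> for the negative axis,
  \<open>y = x * n\<close> satisfies \<open>star y * y = - (a * n)\<close>. Since \<open>y * star y + star y * y\<close> is a sum of
  squares, \<open>y * star y\<close> is positive, and comparing norms in \<open>star y * (T - y * star y) * y\<close>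
  gives \<open>n = 0\<close>.\<close>

lemma star_mult_self_strictly_positive:
  fixes x :: "'a::unital_cstar_algebra"
  assumes g: "g * (star x * x) = 1" "(star x * x) * g = 1"
  shows "strictly_positive (star x * x)"
proof -
  define h where "h = star x * x"
  have sh: "star h = h" by (simp add: h_def star_mult star_star)
  have gh: "g * h = 1" "h * g = 1" using g by (simp_all add: h_def)
  have sg: "star g = g" using gh sh by (rule star_inverse)
  \<comment> \<open>Scaled so that \<open>1 - e *\<^sub>R (g * g)\<close> has a root
    \<open>c\<close>; then \<open>h * h\<close> is \<open>e\<close> plus the square of
    \<open>h * c\<close>, hence strictly positive.\<close>
  define e where "e = 1 / (norm (g * g) + 1)"
  have e: "e > 0" by (simp add: e_def add_nonneg_pos)
  have "norm (e *\<^sub>R (g * g)) < 1"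
    by (simp add: e_def divide_less_eq add_nonneg_pos)
  moreover have "star (e *\<^sub>R (g * g)) = e *\<^sub>R (g * g)" by (simp add: star_scaleR star_mult sg)
  ultimately obtain c where c: "c * c = 1 - e *\<^sub>R (g * g)" "star c = c"
      "\<And>u. u * (e *\<^sub>R (g * g)) = e *\<^sub>R (g * g) * u \<Longrightarrow> u * c = c * u"
    using one_minus_sqrt by blast
  have "h * (g * g) = g * g * h" by (metis gh mult.assoc mult_1_left mult_1_right)
  then have hc: "h * c = c * h" by (intro c(3)) simp
  have "star (h * c) = h * c" using hc by (simp add: star_mult sh c(2))
  moreover have "e *\<^sub>R 1 + (h * c) * (h * c) = h * h"
  proof -
    have "(h * c) * (h * c) = h * h * (c * c)" by (metis hc mult.assoc)
    also have "\<dots> = h * h - e *\<^sub>R (h * (h * g) * g)"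
      by (simp add: c(1) right_diff_distrib mult.assoc)
    finally show ?thesis by (simp add: gh)
  qed
  ultimately have "strictly_positive (h * h)"
    using scaleR_plus_square_strictly_positive[of "h * c" e] e by simp
  then obtain a where a: "a * a = h * h" "strictly_positive a"
      "\<And>u. u * (h * h) = h * h * u \<Longrightarrow> u * a = a * u"
    using strictly_positive_sqrt by blast
  have ha: "h * a = a * h" by (rule a(3)) (simp add: mult.assoc)
  obtain S where S: "norm (S *\<^sub>R 1 - a) < S" and sa: "star a = a"
    using a(2) by (auto simp: strictly_positive_def)
  obtain b where b: "b * a = 1" "a * b = 1" using a(2) by (rule strictly_positive_inverse)
  obtain d where d: "d * d = a" "strictly_positive d" "\<And>u. u * a = a * u \<Longrightarrow> u * d = d * u"
    using a(2) strictly_positive_sqrt by blast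
  have sd: "star d = d" using d(2) by (simp add: strictly_positive_def)
  have sb: "star b = b" using b sa by (rule star_inverse)
  have hb: "h * b = b * h" using b ha by (rule inverse_commute)
  \<comment> \<open>\<open>a\<close> is the absolute value of \<open>h\<close> and \<open>b\<close>
    its inverse, so \<open>z\<close> is the sign of \<open>h\<close>, and \<open>n\<close> below
    projects onto its eigenvalue -1.\<close>
  define z where "z = h * b"
  have sz: "star z = z" by (simp add: z_def star_mult sb sh hb)
  have za: "z * a = h" "a * z = h" 
    unfolding z_def by (metis b hb mult.assoc mult_1_left mult_1_right)+
  have "z * z = h * (b * h) * b" by (simp add: z_def mult.assoc)
  also have "\<dots> = (a * a) * b * b" by (simp add: mult.assoc a(1) flip: hb)
  also have "\<dots> = 1" by (simp add: mult.assoc b)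
  finally have zz: "z * z = 1" .
  define n where "n = (1/2) *\<^sub>R (1 - z)"
  have sn: "star n = n" by (simp add: n_def star_scaleR star_diff sz)
  have nn: "n * n = n"
    by (simp add: n_def algebra_simps zz) (simp flip: scaleR_left.add)
  have an: "n * a = a * n" by (simp add: n_def algebra_simps za)
  have dn: "n * d = d * n" using an by (rule d(3))
  have hz: "h * z = a" using za zz by (metis mult.assoc mult_1_right)
  have hn: "h * n = - (a * n)" by (simp add: n_def algebra_simps za hz)
  have hn': "n * h = h * n" by (metis an hn ha sh sn star_minus star_mult sa)
  define y where "y = x * n"
  have "star y * y = n * h * n" by (simp add: y_def h_def star_mult sn mult.assoc)
  also have "\<dots> = - (a * n)" by (simp add: hn' mult.assoc nn hn)
  finally have yy: "star y * y = - (a * n)" .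
  have "star (y - star y) = - (y - star y)" by (simp add: star_diff star_star)
  then obtain s where s: "star s = s" "s * s = - ((y - star y) * (y - star y))"
    by (rule skew_adjoint_square)
  define t where "t = y + star y"
  have st: "star t = t" by (simp add: t_def star_add star_star add.commute)
  have sdn: "star (d * n) = d * n" by (simp add: star_mult sd sn dn)
  have dndn: "(d * n) * (d * n) = a * n" by (metis d(1) dn mult.assoc nn)
  obtain T1 where T1: "norm (T1 *\<^sub>R 1 - t * t) \<le> T1" using st by (rule square_positive)
  obtain T2 where T2: "norm (T2 *\<^sub>R 1 - s * s) \<le> T2" using s(1) by (rule square_positive)
  obtain T3 where T3: "norm (T3 *\<^sub>R 1 - a * n) \<le> T3" using sdn square_positive dndn by metis
  define T where "T = T1 / 2 + T2 / 2 + T3"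
  \<comment> \<open>\<open>t\<close> and \<open>s\<close> play the role of twice the real and
    imaginary parts of \<open>y\<close>. Since \<open>star y * y = - (a * n)\<close> and
    \<open>a * n\<close> is itself a square, \<open>y * star y\<close> becomes a positive
    combination of squares.\<close>
  have "t * t + s * s = 2 *\<^sub>R (y * star y + star y * y)"
    unfolding s t_def by (simp add: algebra_simps scaleR_2)
  then have "y * star y = (1/2) *\<^sub>R (t * t) + (1/2) *\<^sub>R (s * s) + a * n"
    using yy by (simp flip: scaleR_add_right)
  then have "T *\<^sub>R 1 - y * star y =
      (1/2) *\<^sub>R (T1 *\<^sub>R 1 - t * t) + (1/2) *\<^sub>R (T2 *\<^sub>R 1 - s * s) + (T3 *\<^sub>R 1 - a * n)"
    by (simp add: T_def algebra_simps)
  also have "norm \<dots> \<le> T"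
    unfolding T_def using T1 T2 T3 by (intro norm_triangle_le add_mono) auto
  finally have T: "norm (T *\<^sub>R 1 - y * star y) \<le> T" .
  have "norm (star y * (T *\<^sub>R 1 - y * star y) * y) \<le> (norm (star y) * T) * norm y"
    by (intro order_trans[OF norm_mult_ineq] mult_right_mono mult_left_mono T) auto
  also have "\<dots> = T * norm (star y * y)" by (simp add: cstar_identity power2_eq_square)
  also have "\<dots> = T * norm (a * n)" by (simp add: yy)
  also have "star y * (T *\<^sub>R 1 - y * star y) * y = T *\<^sub>R (star y * y) - (star y * y) * (star y * y)"
    by (simp add: algebra_simps)
  also have "\<dots> = - (T *\<^sub>R (a * n) + a * (a * n))"
    unfolding yy by (simp add: mult.assoc) (metis an mult.assoc nn)
  finally have le: "norm (T *\<^sub>R (a * n) + a * (a * n)) \<le> T * norm (a * n)"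
    by (simp only: norm_minus_cancel)
  \<comment> \<open>The last summand has norm strictly below \<open>S * norm (a * n)\<close> unless
    \<open>a * n = 0\<close>; with the bound \<open>le\<close> on the first, this forces
    \<open>a * n = 0\<close>.\<close>
  have "(T + S) *\<^sub>R (a * n) = (T *\<^sub>R (a * n) + a * (a * n)) + (S *\<^sub>R 1 - a) * (a * n)"
    by (simp add: algebra_simps)
  also have "norm \<dots> \<le> T * norm (a * n) + norm (S *\<^sub>R 1 - a) * norm (a * n)"
    by (intro norm_triangle_le add_mono le norm_mult_ineq)
  also have "norm ((T + S) *\<^sub>R (a * n)) = T * norm (a * n) + S * norm (a * n)"
  proof -
    have "T \<ge> 0" "S \<ge> 0" using T S by (meson norm_ge_zero order_trans less_imp_le)+
    then show ?thesis by (simp add: distrib_right)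
  qed
  finally have "(S - norm (S *\<^sub>R 1 - a)) * norm (a * n) \<le> 0" by (simp add: algebra_simps)
  then have "norm (a * n) \<le> 0" using S by (simp add: mult_le_0_iff)
  then have "a * n = 0" by simp
  then have "a = h" by (simp add: n_def algebra_simps za)
  then show ?thesis using a(2) by (simp add: h_def)
qed

text \<open>Here \<open>k = (star x * x) powr (- 1/2)\<close>, and \<open>x * k\<close> is the isometry in the polar decomposition
  of \<open>x\<close>.\<close>

lemma left_invertible_polar:
  fixes x :: "'a::unital_cstar_algebra"
  assumes "y * x = 1"
  obtains k where "star k = k" "star (x * k) * (x * k) = 1" "k * k * (star x * x) = 1"
    "\<And>u. u * (star x * x) = star x * x * u \<Longrightarrow> u * k = k * u"
proof -
  obtain g where "g * (star x * x) = 1" "(star x * x) * g = 1"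
    using assms by (rule star_mult_self_invertible)
  then have "strictly_positive (star x * x)" by (rule star_mult_self_strictly_positive)
  then obtain c where c: "c * c = star x * x" "strictly_positive c"
      "\<And>u. u * (star x * x) = star x * x * u \<Longrightarrow> u * c = c * u"
    using strictly_positive_sqrt by blast
  obtain k where k: "k * c = 1" "c * k = 1" using c(2) by (rule strictly_positive_inverse)
  have sk: "star k = k" using k c(2) by (auto intro: star_inverse simp: strictly_positive_def)
  have "star (x * k) * (x * k) = k * (star x * x) * k" by (simp add: star_mult sk mult.assoc)
  also have "\<dots> = 1" unfolding c(1)[symmetric] by (metis k mult.assoc mult_1_left)
  finally have "star (x * k) * (x * k) = 1" .
  moreover have "k * k * (star x * x) = 1"
    unfolding c(1)[symmetric] by (metis k mult.assoc mult_1_left)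
  moreover have "u * k = k * u" if "u * (star x * x) = star x * x * u" for u
    using k c(3)[OF that] by (rule inverse_commute)
  ultimately show ?thesis using sk that by blast
qed


section \<open>The semigroup of projections\<close>

lemma is_projection_zero [simp]: "is_projection (0::'a::cstar_algebra)"
  by (simp add: is_projection_def)

text \<open>Idempotence of \<open>p + q\<close> makes \<open>p\<close> and \<open>q\<close>
  anticommute; multiplying by \<open>p\<close> shows that they also commute, so both products
  vanish.\<close>

lemma proj_orthogonal_iff:
  fixes p q :: "'a::cstar_algebra"
  shows "proj_orthogonal p q \<longleftrightarrow> is_projection p \<and> is_projection q \<and> p * q = 0 \<and> q * p = 0"
proof
  assume "proj_orthogonal p q"
  then have p: "p * p = p" "star p = p" and q: "q * q = q" "star q = q"
    and pq: "(p + q) * (p + q) = p + q" and *: "is_projection p" "is_projection q"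
    by (auto simp: proj_orthogonal_def is_projection_def)
  have neg: "q * p = - (p * q)" using pq by (simp add: algebra_simps p q eq_neg_iff_add_eq_0)
  have "p * q = p * (p * q)" by (simp add: p flip: mult.assoc)
  also have "\<dots> = - (p * q * p)" using neg by (simp add: mult.assoc)
  also have "\<dots> = - (- (q * p) * p)" using neg by simp
  also have "\<dots> = q * p" by (simp add: mult.assoc p)
  finally have "p * q = - (p * q)" using neg by simp
  then have "2 *\<^sub>R (p * q) = 0" by (metis add.right_inverse scaleR_2)
  then have "p * q = 0" by simp
  then show "is_projection p \<and> is_projection q \<and> p * q = 0 \<and> q * p = 0" using neg * by simp
qed (auto simp: proj_orthogonal_def is_projection_def algebra_simps star_add)

lemma proj_orthogonal_sym: "proj_orthogonal p q \<Longrightarrow> proj_orthogonal q p"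
  by (simp add: proj_orthogonal_iff)

text \<open>By the C*-identity it is enough that the defect \<open>v - v * q\<close> satisfies
  \<open>star x * x = 0\<close>, which is the computation \<open>q - q - q + q\<close>.\<close>

lemma partial_isometry_mult:
  fixes v :: "'a::cstar_algebra"
  assumes "is_projection (star v * v)"
  shows "v * (star v * v) = v"
proof -
  define q where "q = star v * v"
  have q: "q * q = q" "star q = q" using assms by (auto simp: q_def is_projection_def)
  have "star (v - v * q) * (v - v * q) = q - q * q - q * q + q * q * q"
    by (simp add: star_diff star_mult q(2) algebra_simps) (simp add: q_def mult.assoc)
  then have "star (v - v * q) * (v - v * q) = 0" by (simp add: q)
  then show ?thesis by (simp add: q_def)
qed

section \<open>Murray-von Neumann equivalence\<close>

lemma mvn_equiv_refl: "is_projection p \<Longrightarrow> mvn_equiv p p"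
  unfolding mvn_equiv_def is_projection_def by (auto intro: exI[of _ p])

lemma mvn_equiv_sym: "mvn_equiv p q \<Longrightarrow> mvn_equiv q p"
  unfolding mvn_equiv_def by (metis star_star)

lemma mvn_equiv_trans:
  fixes p q r :: "'a::cstar_algebra"
  assumes "mvn_equiv p q" "mvn_equiv q r" "is_projection p" "is_projection q" "is_projection r"
  shows "mvn_equiv p r"
proof -
  obtain v where v: "v * star v = p" "star v * v = q" using assms(1) by (auto simp: mvn_equiv_def)
  obtain w where w: "w * star w = q" "star w * w = r" using assms(2) by (auto simp: mvn_equiv_def)
  have "(v * w) * star (v * w) = v * q * star v" by (simp add: star_mult mult.assoc flip: w(1))
  also have "v * q = v" using partial_isometry_mult[of v] assms(4) v by simp
  finally have 1: "(v * w) * star (v * w) = p" by (simp add: v)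
  have "star (v * w) * (v * w) = star w * (q * w)" by (simp add: star_mult mult.assoc flip: v(2))
  also have "q * w = w" using partial_isometry_mult[of w] assms(5) w by (simp add: mult.assoc flip: w(1))
  finally show ?thesis using 1 w unfolding mvn_equiv_def by auto
qed

text \<open>The sum \<open>v + w\<close> implements the equivalence: its cross terms vanish because
  two orthogonal projections can be inserted between the factors.\<close>

lemma mvn_equiv_add:
  fixes p q p' q' :: "'a::cstar_algebra"
  assumes "mvn_equiv p p'" "mvn_equiv q q'" "proj_orthogonal p q" "proj_orthogonal p' q'"
  shows "mvn_equiv (p + q) (p' + q')"
proof -
  obtain v where v: "v * star v = p" "star v * v = p'" using assms(1) by (auto simp: mvn_equiv_def)
  obtain w where w: "w * star w = q" "star w * w = q'" using assms(2) by (auto simp: mvn_equiv_def)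
  have orth: "p * q = 0" "q * p = 0" "p' * q' = 0" "q' * p' = 0"
    using assms by (auto simp: proj_orthogonal_iff)
  have v': "v * p' = v" "p * v = v" and w': "w * q' = w" "q * w = w"
    using partial_isometry_mult[of v] partial_isometry_mult[of w] v w assms(3,4)
    by (auto simp: proj_orthogonal_iff simp flip: mult.assoc)
  have sv: "p' * star v = star v" "star v * p = star v" and sw: "q' * star w = star w" "star w * q = star w"
    using v' w' assms(3,4) by (metis is_projection_def proj_orthogonal_iff star_mult)+
  have "v * star w = v * (p' * q') * star w" by (simp add: mult.assoc sw) (simp add: v' flip: mult.assoc)
  moreover have "w * star v = w * (q' * p') * star v" by (simp add: mult.assoc sv) (simp add: w' flip: mult.assoc)
  moreover have "star v * w = star v * (p * q) * w" by (simp add: mult.assoc w') (simp add: sv flip: mult.assoc)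
  moreover have "star w * v = star w * (q * p) * v" by (simp add: mult.assoc v') (simp add: sw flip: mult.assoc)
  ultimately have "v * star w = 0" "w * star v = 0" "star v * w = 0" "star w * v = 0"
    by (simp_all add: orth)
  then have "(v + w) * star (v + w) = p + q" "star (v + w) * (v + w) = p' + q'"
    by (simp_all add: star_add algebra_simps v w)
  then show ?thesis unfolding mvn_equiv_def by blast
qed

text \<open>Enlarging the cancelling summand \<open>c\<close> to \<open>c \<otimes> z\<close> lets
  \<open>x\<close> be absorbed or inserted. So both classes, taken as sets of pairs, have the same
  members.\<close>

lemma grothendieck_map_eq_one:
  fixes M (structure)
  assumes "comm_monoid M" "x \<in> carrier M" "z \<in> carrier M" "x \<otimes> z = z"
  shows "grothendieck_map M x = grothendieck_map M \<one>"
proof -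
  interpret comm_monoid M by fact
  have *: "x \<otimes> b \<otimes> (c \<otimes> z) = b \<otimes> c \<otimes> z" if "b \<in> carrier M" "c \<in> carrier M" for b c
  proof -
    have "x \<otimes> b \<otimes> (c \<otimes> z) = b \<otimes> c \<otimes> (x \<otimes> z)"
      using assms that by (simp add: m_ac)
    then show ?thesis by (simp add: assms)
  qed
  have "(\<exists>c\<in>carrier M. x \<otimes> b \<otimes> c = a \<otimes> \<one> \<otimes> c) \<longleftrightarrow> (\<exists>c\<in>carrier M. \<one> \<otimes> b \<otimes> c = a \<otimes> \<one> \<otimes> c)"
    if ab: "a \<in> carrier M" "b \<in> carrier M" for a b
  proof
    assume "\<exists>c\<in>carrier M. x \<otimes> b \<otimes> c = a \<otimes> \<one> \<otimes> c"
    then obtain c where c: "c \<in> carrier M" "x \<otimes> b \<otimes> c = a \<otimes> c" using ab by auto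
    have "b \<otimes> (c \<otimes> z) = (x \<otimes> b \<otimes> c) \<otimes> z"
      using *[OF ab(2) c(1)] ab c(1) assms by (simp add: m_assoc)
    also have "\<dots> = a \<otimes> (c \<otimes> z)" using c ab assms by (simp add: m_assoc)
    finally show "\<exists>c\<in>carrier M. \<one> \<otimes> b \<otimes> c = a \<otimes> \<one> \<otimes> c"
      using ab c(1) assms by (intro bexI[of _ "c \<otimes> z"]) auto
  next
    assume "\<exists>c\<in>carrier M. \<one> \<otimes> b \<otimes> c = a \<otimes> \<one> \<otimes> c"
    then obtain c where c: "c \<in> carrier M" "b \<otimes> c = a \<otimes> c" using ab by auto
    have "x \<otimes> b \<otimes> (c \<otimes> z) = a \<otimes> (c \<otimes> z)"
      using *[OF ab(2) c(1)] c ab assms by (simp add: m_assoc)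
    then show "\<exists>c\<in>carrier M. x \<otimes> b \<otimes> c = a \<otimes> \<one> \<otimes> c"
      using ab c(1) assms by (intro bexI[of _ "c \<otimes> z"]) auto
  qed
  then have "w \<in> grothendieck_map M x \<longleftrightarrow> w \<in> grothendieck_map M \<one>" for w
    using assms(2) one_closed unfolding grothendieck_map_def grothendieck_rel_def
    by (cases w) (simp del: l_one r_one cong: conj_cong)
  then show ?thesis by blast
qed

text \<open>Isolating the algebraic clauses keeps the index type of the net out of the arguments on
  projections.\<close>

locale finite_type_ideal_projections =
  fixes F :: "'a::unital_cstar_algebra set"
  assumes zero_mem: "0 \<in> F"
    and add_mem: "x \<in> F \<Longrightarrow> y \<in> F \<Longrightarrow> x + y \<in> F"
    and mult_mem_left: "y \<in> F \<Longrightarrow> x * y \<in> F"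
    and mult_mem_right: "x \<in> F \<Longrightarrow> x * y \<in> F"
    and orthogonal_copy: "p \<in> projections F \<Longrightarrow> q \<in> projections F \<Longrightarrow>
      \<exists>v. v * star v = q \<and> proj_orthogonal (star v * v) p"
begin

section \<open>The monoid of classes of projections in the ideal\<close>

abbreviation cls :: "'a \<Rightarrow> 'a set" where "cls p \<equiv> mvn_rel F `` {p}"

abbreviation S :: "'a set monoid" where "S \<equiv> proj_semigroup F"

lemma diff_mem: "x \<in> F \<Longrightarrow> y \<in> F \<Longrightarrow> x - y \<in> F"
  using add_mem[of x "- 1 * y"] mult_mem_left[of y "- 1"] by simp

lemma projectionsD: "p \<in> projections F \<Longrightarrow> is_projection p" "p \<in> projections F \<Longrightarrow> p \<in> F"
  by (auto simp: projections_def)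

lemma zero_projection: "0 \<in> projections F"
  by (simp add: projections_def zero_mem)

lemma add_projection:
  "p \<in> projections F \<Longrightarrow> q \<in> projections F \<Longrightarrow> proj_orthogonal p q \<Longrightarrow> p + q \<in> projections F"
  by (auto simp: projections_def add_mem proj_orthogonal_def)

lemma equiv_mvn_rel: "equiv (projections F) (mvn_rel F)"
  by (rule equivI)
    (auto simp: refl_on_def sym_def trans_def mvn_rel_def
      intro: mvn_equiv_refl mvn_equiv_sym mvn_equiv_trans dest: projectionsD)

lemma cls_eq_iff:
  "p \<in> projections F \<Longrightarrow> q \<in> projections F \<Longrightarrow> cls p = cls q \<longleftrightarrow> mvn_equiv p q"
  using eq_equiv_class_iff[OF equiv_mvn_rel] by (simp add: mvn_rel_def)

lemma carrierE:
  assumes "X \<in> carrier S" obtains p where "p \<in> projections F" "X = cls p"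
  using assms by (auto simp: proj_semigroup_def elim: quotientE)

lemma cls_carrier: "p \<in> projections F \<Longrightarrow> cls p \<in> carrier S"
  by (simp add: proj_semigroup_def quotientI)

lemma cls_orthogonal_rep:
  assumes "p \<in> projections F" "q \<in> projections F"
  obtains q' where "q' \<in> projections F" "cls q' = cls q" "proj_orthogonal p q'"
proof -
  obtain v where v: "v * star v = q" "proj_orthogonal (star v * v) p"
    using orthogonal_copy[OF assms] by blast
  have pr: "is_projection (star v * v)" using v by (simp add: proj_orthogonal_def)
  \<comment> \<open>The partial isometry is only known to lie in the whole algebra; factoring
    through \<open>q\<close> puts \<open>star v * v\<close> into the ideal.\<close>
  then have "star v * v = star v * (q * v)"
    unfolding v(1)[symmetric] by (simp add: is_projection_def mult.assoc)
  also have "\<dots> \<in> F" using assms(2) by (simp add: mult_mem_left mult_mem_right projectionsD)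
  finally have mem: "star v * v \<in> projections F" using pr by (simp add: projections_def)
  have "mvn_equiv q (star v * v)" using v(1) by (auto simp: mvn_equiv_def)
  then have "mvn_equiv (star v * v) q" by (rule mvn_equiv_sym)
  then show ?thesis using that[OF mem] v(2) assms mem by (simp add: cls_eq_iff proj_orthogonal_sym)
qed

text \<open>The union in the product runs over equal classes, because equivalence is additive, and
  it is nonempty, because \<open>p\<close> and \<open>q\<close> themselves contribute.\<close>

lemma cls_mult:
  assumes "p \<in> projections F" "q \<in> projections F" "proj_orthogonal p q"
  shows "cls p \<otimes>\<^bsub>S\<^esub> cls q = cls (p + q)"
proof -
  have same: "cls (p' + q') = cls (p + q)" if "p' \<in> cls p" "q' \<in> cls q" "proj_orthogonal p' q'" for p' q'
  proof -
    have "p' \<in> projections F" "q' \<in> projections F" "mvn_equiv p p'" "mvn_equiv q q'"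
      using that by (auto simp: mvn_rel_def)
    then show ?thesis using assms that(3)
      by (simp add: cls_eq_iff add_projection mvn_equiv_add mvn_equiv_sym)
  qed
  have self: "p \<in> cls p" "q \<in> cls q"
    using assms equiv_class_self[OF equiv_mvn_rel] by blast+
  have "cls p \<otimes>\<^bsub>S\<^esub> cls q = (\<Union>p'\<in>cls p. \<Union>q'\<in>{q' \<in> cls q. proj_orthogonal p' q'}. cls (p' + q'))"
    by (simp add: proj_semigroup_def)
  also have "\<dots> = (\<Union>p'\<in>cls p. \<Union>q'\<in>{q' \<in> cls q. proj_orthogonal p' q'}. cls (p + q))"
    by (intro SUP_cong refl same) blast+
  also have "\<dots> = cls (p + q)" using self assms(3) by blast
  finally show ?thesis .
qed

lemma comm_monoid_proj_semigroup: "comm_monoid S"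
proof (rule comm_monoidI)
  have one: "\<one>\<^bsub>S\<^esub> = cls 0" by (simp add: proj_semigroup_def)
  fix X Y Z assume X: "X \<in> carrier S" and Y: "Y \<in> carrier S" and Z: "Z \<in> carrier S"
  obtain p where p: "p \<in> projections F" "X = cls p" using X by (rule carrierE)
  obtain q0 where "q0 \<in> projections F" "Y = cls q0" using Y by (rule carrierE)
  then obtain q where q: "q \<in> projections F" "Y = cls q" "proj_orthogonal p q"
    using cls_orthogonal_rep[OF p(1)] by metis
  have pq: "p + q \<in> projections F" using p q by (simp add: add_projection)
  \<comment> \<open>Choosing the third representative orthogonal to \<open>p + q\<close> makes all
    three pairwise orthogonal, so associativity reduces to that of addition.\<close>
  obtain r0 where "r0 \<in> projections F" "Z = cls r0" using Z by (rule carrierE)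
  then obtain r where r: "r \<in> projections F" "Z = cls r" "proj_orthogonal (p + q) r"
    using cls_orthogonal_rep[OF pq] by metis
  have XY: "X \<otimes>\<^bsub>S\<^esub> Y = cls (p + q)" using p q by (simp add: cls_mult)
  show "X \<otimes>\<^bsub>S\<^esub> Y \<in> carrier S" using XY pq by (simp add: cls_carrier)
  show "X \<otimes>\<^bsub>S\<^esub> Y = Y \<otimes>\<^bsub>S\<^esub> X"
    using XY p q by (simp add: cls_mult proj_orthogonal_sym add.commute)
  show "\<one>\<^bsub>S\<^esub> \<otimes>\<^bsub>S\<^esub> X = X"
    using p zero_projection by (simp add: one cls_mult proj_orthogonal_iff projectionsD)
  have orth: "p * q = 0" "q * p = 0" "(p + q) * r = 0" "r * (p + q) = 0"
    and idem: "p * p = p" "q * q = q"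
    using q(3) r(3) by (auto simp: proj_orthogonal_iff is_projection_def)
  have "p * r = p * ((p + q) * r)" "q * r = q * ((p + q) * r)"
    "r * p = r * (p + q) * p" "r * q = r * (p + q) * q"
    by (simp_all add: algebra_simps) (simp_all add: orth idem flip: mult.assoc add: mult.assoc)
  then have "p * r = 0" "q * r = 0" "r * p = 0" "r * q = 0" by (simp_all add: orth)
  then have qr: "proj_orthogonal q r" and pqr: "proj_orthogonal p (q + r)"
    using p q r by (auto simp: proj_orthogonal_iff algebra_simps orth projectionsD is_projection_def star_add)
  have "X \<otimes>\<^bsub>S\<^esub> Y \<otimes>\<^bsub>S\<^esub> Z = cls (p + q + r)" using XY pq r by (simp add: cls_mult)
  also have "\<dots> = cls (p + (q + r))" by (simp add: add.assoc)
  also have "\<dots> = X \<otimes>\<^bsub>S\<^esub> (Y \<otimes>\<^bsub>S\<^esub> Z)"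
    using p q r qr pqr by (simp add: cls_mult add_projection)
  finally show "X \<otimes>\<^bsub>S\<^esub> Y \<otimes>\<^bsub>S\<^esub> Z = X \<otimes>\<^bsub>S\<^esub> (Y \<otimes>\<^bsub>S\<^esub> Z)" .
qed (simp add: proj_semigroup_def zero_projection quotientI)

text \<open>For \<open>s = p - r\<close>, \<open>[s] + [p] = [s] + [r] = [p]\<close> holds already
  in the monoid, so \<open>s\<close> and 0 have the same class in \<open>K(F)\<close>. Cancellation
  gives \<open>s \<sim> 0\<close>, and only 0 is equivalent to 0.\<close>

lemma mvn_equiv_subprojection_eq:
  assumes canc: "K_cancellation F"
    and p: "p \<in> projections F" and r: "r \<in> projections F"
    and rp: "r * p = r" and eq: "mvn_equiv r p"
  shows "r = p"
proof -
  have "star (r * p) = star r" by (simp add: rp)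
  then have pr: "p * r = r" using p r by (simp add: star_mult projections_def is_projection_def)
  define s where "s = p - r"
  have rr: "r * r = r"
    using r by (auto simp: projections_def is_projection_def)
  have s: "s \<in> projections F"
    using diff_mem[of p r] p r
    by (simp add: projections_def is_projection_def s_def algebra_simps star_diff rp pr)
  have "proj_orthogonal s r"
    using s r by (simp add: proj_orthogonal_iff projectionsD s_def algebra_simps pr rp rr)
  then have "cls s \<otimes>\<^bsub>S\<^esub> cls r = cls p" using s r by (simp add: cls_mult) (simp add: s_def)
  moreover have "cls r = cls p" using eq p r by (simp add: cls_eq_iff)
  ultimately have "cls s \<otimes>\<^bsub>S\<^esub> cls p = cls p" by simp
  then have "grothendieck_map S (cls s) = grothendieck_map S \<one>\<^bsub>S\<^esub>"
    using comm_monoid_proj_semigroup cls_carrier s p by (intro grothendieck_map_eq_one) auto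
  then have "K_class F s = K_class F 0" by (simp add: K_class_def proj_semigroup_def)
  then have "mvn_equiv s 0" using canc s zero_projection by (simp add: K_cancellation_def)
  then have "s = 0" by (auto simp: mvn_equiv_def)
  then show ?thesis by (simp add: s_def)
qed

end

lemma finite_type_ideal_projections:
  "finite_type_ideal TYPE('i) F \<Longrightarrow> finite_type_ideal_projections F"
  unfolding finite_type_ideal_def complex_subalgebra_def finite_type_ideal_projections_def by blast

section \<open>Perturbations of invertible elements\<close>

text \<open>The element is block diagonal for \<open>p\<close> and the identity on the complementary
  block, so the question is settled in the block of \<open>p\<close>, where finiteness of
  \<open>p\<close> applies.\<close>

lemma left_invertible_block_diagonal:
  fixes F :: "'a::unital_cstar_algebra set"
  assumes F: "finite_type_ideal_projections F" and canc: "K_cancellation F"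
    and p: "p \<in> projections F" and yx: "y * (1 + p * g * p) = 1"
  shows "(1 + p * g * p) * y = 1"
proof -
  interpret finite_type_ideal_projections F by fact
  define x where "x = 1 + p * g * p"
  have pp: "p * p = p" "star p = p" using p by (auto simp: projections_def is_projection_def)
  have pp': "p * (p * z) = p * z" for z by (simp add: pp flip: mult.assoc)
  obtain k where k: "star k = k" "star (x * k) * (x * k) = 1" "k * k * (star x * x) = 1"
      "\<And>u. u * (star x * x) = star x * x * u \<Longrightarrow> u * k = k * u"
    using left_invertible_polar yx unfolding x_def by blast
  have px: "p * x = x * p" "p * star x = star x * p"
    by (simp_all add: x_def star_add star_mult pp pp' algebra_simps)
  have pk: "p * k = k * p" by (rule k(4)) (metis px mult.assoc)
  define v where "v = x * k"
  have vv: "star v * v = 1" using k(2) by (simp add: v_def)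
  have pv: "p * v = v * p" unfolding v_def by (metis pk px(1) mult.assoc)
  then have pv': "p * star v = star v * p" by (metis pp(2) star_mult)
  \<comment> \<open>This is the range projection of \<open>v * p\<close>; it lies below
    \<open>p\<close> because \<open>v\<close> commutes with \<open>p\<close>.\<close>
  define r where "r = p * v * star v"
  have r_eq: "r = (v * p) * star (v * p)"
    unfolding r_def by (metis pv pv' pp mult.assoc star_mult)
  have "star (v * p) * (v * p) = p"
    by (simp add: star_mult pp) (metis vv pp(1) mult.assoc mult_1_left)
  then have eq: "mvn_equiv r p" unfolding r_eq mvn_equiv_def by blast
  have sr: "star r = r" unfolding r_eq by (simp add: star_mult star_star)
  have "r * r = p * v * (star v * p * v) * star v" unfolding r_def by (simp add: mult.assoc)
  also have "star v * p * v = p" by (metis pv vv mult.assoc mult_1_left)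
  also have "p * v * p * star v = r" unfolding r_def by (metis pv pp(1) mult.assoc)
  finally have "r \<in> projections F"
    using p sr by (simp add: projections_def is_projection_def r_def mult_mem_right mult.assoc)
  moreover have "r * p = r" unfolding r_def by (metis pv pv' pp(1) mult.assoc)
  ultimately have "r = p" using mvn_equiv_subprojection_eq[OF canc p] eq by blast
  moreover have "r = p * (x * (k * k) * star x)"
    by (simp add: r_def v_def star_mult k(1) mult.assoc)
  ultimately have 1: "p * (x * (k * k) * star x) = p" by simp
  \<comment> \<open>On the complement of \<open>p\<close> both \<open>x\<close> and
    \<open>star x\<close> act as the unit, so there the identity
    \<open>k * k * (star x * x) = 1\<close> suffices.\<close>
  have qx: "(1 - p) * x = 1 - p" "star x * (1 - p) = 1 - p"
    by (simp_all add: x_def star_add star_mult pp pp' algebra_simps)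
  have "(1 - p) * (x * (k * k) * star x) = (1 - p) * (k * k) * star x"
    by (metis qx(1) mult.assoc)
  also have "\<dots> = (k * k) * ((1 - p) * star x)"
    using pk by (simp add: algebra_simps) (metis mult.assoc)
  also have "(1 - p) * star x = star x * x * (1 - p)"
  proof -
    have "x * (1 - p) = 1 - p" by (simp add: x_def pp pp' algebra_simps)
    moreover have "(1 - p) * star x = 1 - p" using px(2) qx(2) by (simp add: algebra_simps)
    ultimately show ?thesis by (simp add: mult.assoc qx(2))
  qed
  also have "k * k * (star x * x * (1 - p)) = 1 - p" using k(3) by (metis mult.assoc mult_1_left)
  \<comment> \<open>The blocks of \<open>p\<close> and \<open>1 - p\<close> add up, so
    \<open>k * k * star x\<close> is a right inverse of \<open>x\<close>; it must equal the left
    inverse \<open>y\<close>.\<close>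
  finally have "x * (k * k) * star x = 1"
    using 1 by (simp add: left_diff_distrib)
  then have "x * (k * k * star x) = 1" by (simp add: mult.assoc)
  then have "y = k * k * star x" using yx unfolding x_def[symmetric] by (metis mult.assoc mult_1_left mult_1_right)
  then show ?thesis using \<open>x * (k * k * star x) = 1\<close> by (simp add: x_def)
qed

text \<open>The error splits into \<open>g - p * g\<close> and \<open>p * (g - g * p)\<close>, with
  \<open>norm p \<le> 1\<close>; directedness gives one index that makes both small.\<close>

lemma finite_type_ideal_approx:
  fixes F :: "'a::unital_cstar_algebra set"
  assumes "finite_type_ideal TYPE('i) F" "g \<in> F" "e > 0"
  obtains p where "p \<in> projections F" "norm (g - p * g * p) < e"
proof -
  obtain I :: "'i set" and leq u where au: "approximate_unit I leq u F"
    and pr: "\<And>i. i \<in> I \<Longrightarrow> is_projection (u i)"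
    using assms(1) unfolding finite_type_ideal_def by blast
  have dir: "directed_preorder I leq" and mem: "\<And>i. i \<in> I \<Longrightarrow> u i \<in> F"
    and conv: "net_converges I leq (\<lambda>i. u i * g) g" "net_converges I leq (\<lambda>i. g * u i) g"
    using au assms(2) by (auto simp: approximate_unit_def)
  obtain i where i: "i \<in> I" "\<And>j. j \<in> I \<Longrightarrow> leq i j \<Longrightarrow> norm (u j * g - g) < e / 2"
    using conv(1) assms(3) unfolding net_converges_def by (meson half_gt_zero)
  obtain k where k: "k \<in> I" "\<And>j. j \<in> I \<Longrightarrow> leq k j \<Longrightarrow> norm (g * u j - g) < e / 2"
    using conv(2) assms(3) unfolding net_converges_def by (meson half_gt_zero)
  obtain j where j: "j \<in> I" "leq i j" "leq k j"
    using dir i(1) k(1) unfolding directed_preorder_def by blast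
  define p where "p = u j"
  have p: "p \<in> projections F" using pr mem j by (simp add: projections_def p_def)
  have "norm (p * (g * p - g)) \<le> 1 * norm (g * p - g)"
    using p by (intro order_trans[OF norm_mult_ineq] mult_right_mono)
      (auto simp: projections_def is_projection_norm_le)
  then have "norm (p * (g * p - g)) < e / 2" using k(2)[OF j(1,3)] by (simp add: p_def)
  moreover have "norm (p * g - g) < e / 2" using i(2)[OF j(1,2)] by (simp add: p_def)
  moreover have "g - p * g * p = - (p * (g * p - g) + (p * g - g))" by (simp add: algebra_simps)
  ultimately have "norm (g - p * g * p) < e"
    using norm_triangle_ineq[of "p * (g * p - g)" "p * g - g"] by (simp only: norm_minus_cancel)
  then show ?thesis using p that by blast
qed

lemma left_inverse_one_plus:
  fixes F :: "'a::unital_cstar_algebra set"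
  assumes F: "finite_type_ideal TYPE('i) F" and canc: "K_cancellation F"
    and g: "g \<in> F" and yx: "y * (1 + g) = 1"
  shows "(1 + g) * y = 1"
proof -
  obtain p where p: "p \<in> projections F" "norm (g - p * g * p) < 1 / (norm y + 1)"
    \<comment> \<open>The bound ensures \<open>norm (y * d) < 1\<close>, so the left inverse
      \<open>y\<close> survives the perturbation up to an invertible factor.\<close>
    using finite_type_ideal_approx[OF F g, of "1 / (norm y + 1)"] by (auto simp: add_nonneg_pos)
  define x' where "x' = 1 + p * g * p"
  define d where "d = g - p * g * p"
  have "norm (y * d) \<le> norm y * norm d" by (rule norm_mult_ineq)
  also have "\<dots> \<le> norm y * (1 / (norm y + 1))"
    using p(2) by (intro mult_left_mono) (auto simp: d_def)
  also have "\<dots> < 1" by (simp add: divide_less_eq add_nonneg_pos)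
  finally obtain m where m: "m * (1 - y * d) = 1" "(1 - y * d) * m = 1"
    by (rule one_minus_invertible)
  have "y * x' = 1 - y * d"
    using yx by (simp add: x'_def d_def algebra_simps)
  then have "(m * y) * x' = 1" using m by (simp add: mult.assoc)
  then have "x' * (m * y) = 1"
    using left_invertible_block_diagonal[OF finite_type_ideal_projections[OF F] canc p(1)]
    unfolding x'_def by blast
  \<comment> \<open>Now \<open>y\<close> has the left inverse \<open>x' * m\<close> and the right
    inverse \<open>1 + g\<close>, so the two coincide.\<close>
  then have "(x' * m) * y = 1" by (simp add: mult.assoc)
  then show ?thesis using yx by (metis mult.assoc mult_1_left mult_1_right)
qed

theorem corollary3p2:
  fixes F :: "'a::unital_cstar_algebra set" and a :: 'a
  assumes "finite_type_ideal TYPE('i) F"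
    and "two_sided_invertible a"
    and "K_cancellation F"
  shows "\<forall>f\<in>F. left_invertible (a + f) \<longleftrightarrow> right_invertible (a + f)"
proof
  fix f assume f: "f \<in> F"
  have ideal: "c * x \<in> F" "x * c \<in> F" "star x \<in> F" if "x \<in> F" for c x
    using assms(1) that by (auto simp: finite_type_ideal_def)
  obtain b where b: "a * b = 1" "b * a = 1" using assms(2) by (auto simp: two_sided_invertible_def)
  show "left_invertible (a + f) \<longleftrightarrow> right_invertible (a + f)"
  proof
    assume "left_invertible (a + f)"
    then obtain y where y: "y * (a + f) = 1" by (auto simp: left_invertible_def)
    \<comment> \<open>Factoring out \<open>a\<close> keeps the perturbation \<open>b * f\<close> in
      the ideal; conjugating with \<open>a\<close> afterwards returns to
      \<open>a + f\<close>.\<close>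
    have af: "a + f = a * (1 + b * f)" using b by (simp add: distrib_left flip: mult.assoc)
    have "(y * a) * (1 + b * f) = 1" using y by (simp add: af mult.assoc)
    then have "(1 + b * f) * (y * a) = 1"
      using left_inverse_one_plus[OF assms(1,3)] ideal f by blast
    then have "a * ((1 + b * f) * (y * a)) * b = 1" by (simp add: b)
    then have "(a * (1 + b * f)) * y * (a * b) = 1" by (simp only: mult.assoc)
    then have "(a + f) * y = 1" by (simp only: af b mult_1_right)
    then show "right_invertible (a + f)" by (auto simp: right_invertible_def)
  next
    assume "right_invertible (a + f)"
    then obtain y where y: "(a + f) * y = 1" by (auto simp: right_invertible_def)
    have af: "a + f = (1 + f * b) * a" using b by (simp add: distrib_right mult.assoc)
    have "(1 + f * b) * (a * y) = 1" using y by (simp add: af mult.assoc)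
    \<comment> \<open>Adjoints turn right invertibility into left invertibility, and
      \<open>star (f * b)\<close> stays in the selfadjoint ideal.\<close>
    then have "star ((1 + f * b) * (a * y)) = 1" by simp
    then have "star (a * y) * (1 + star (f * b)) = 1" by (simp only: star_mult star_add star_one)
    then have "(1 + star (f * b)) * star (a * y) = 1"
      using left_inverse_one_plus[OF assms(1,3)] ideal f by blast
    then have "star ((1 + star (f * b)) * star (a * y)) = 1" by simp
    then have "(a * y) * (1 + f * b) = 1" by (simp only: star_mult star_add star_one star_star)
    then have "b * (a * y * (1 + f * b)) * a = 1" by (simp add: b)
    then have "(b * a) * y * ((1 + f * b) * a) = 1" by (simp only: mult.assoc)
    then have "y * (a + f) = 1" by (simp only: af b mult_1_left)
    then show "left_invertible (a + f)" by (auto simp: left_invertible_def)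
  qed
qed

end
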